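(* For any unicyclic graph $G$ with maximum degree $\mathcal D=\max_v d_v$, $$\lambda_{\max}(R_G)\ \le\ \begin{cases}1-\dfrac{4}{\mathcal D}+\dfrac{2\sqrt{\mathcal D-1}}{\mathcal D}, & 2\le\mathcal D\le18,\\[8pt] \dfrac{15+6\sqrt2}{19}, & \mathcal D\ge19.\end{cases}$$
   Context: Unicyclic: a finite connected simple graph with $|E|=|V|$ (equivalently, containing exactly one cycle). $d_v$ is the degree of $v$. Ricci matrix: $R_G\in\mathbb{R}^{E\times E}$ is the matrix (symmetric) with diagonal entries $-(1/d_x+1/d_y)$ for $e=\{x,y\}$, entry $1/d_z$ for $e\ne e'$ with $e\cap e'=\{z\}$, and $0$ for disjoint edges; $\lambda_{\max}(R_G)$ is its largest eigenvalue. *)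

theory Defs
  imports Complex_Main "Jordan_Normal_Form.Spectral_Radius"
begin

definition simple_graph :: "'a set \<Rightarrow> 'a set set \<Rightarrow> bool" where
  "simple_graph V E \<longleftrightarrow> finite V \<and> (\<forall>e\<in>E. e \<subseteq> V \<and> card e = 2)"

definition connected_graph :: "'a set \<Rightarrow> 'a set set \<Rightarrow> bool" where
  "connected_graph V E \<longleftrightarrow>
     V \<noteq> {} \<and> (\<forall>u\<in>V. \<forall>v\<in>V. (u, v) \<in> {(x, y). {x, y} \<in> E}\<^sup>*)"

definition unicyclic :: "'a set \<Rightarrow> 'a set set \<Rightarrow> bool" where
  "unicyclic V E \<longleftrightarrow> simple_graph V E \<and> connected_graph V E \<and> card E = card V"

definition vertex_degree :: "'a set set \<Rightarrow> 'a \<Rightarrow> nat" where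
  "vertex_degree E v = card {e \<in> E. v \<in> e}"

definition max_degree :: "'a set \<Rightarrow> 'a set set \<Rightarrow> nat" where
  "max_degree V E = Max (vertex_degree E ` V)"

definition ricci_entry :: "'a set set \<Rightarrow> 'a set \<Rightarrow> 'a set \<Rightarrow> real" where
  "ricci_entry E e e' =
     (if e = e' then - (\<Sum>x\<in>e. 1 / real (vertex_degree E x))
      else if e \<inter> e' = {} then 0
      else 1 / real (vertex_degree E (the_elem (e \<inter> e'))))"

(* Library matrices are indexed by {0..<n}, so the E x E matrix is written with respect to a list
   es that enumerates E without repetition.  By eigenvalue_ricci_matrix_iff below, the choice of
   the enumeration does not affect the eigenvalues. *)
definition ricci_matrix :: "'a set set \<Rightarrow> 'a set list \<Rightarrow> real mat" where
  "ricci_matrix E es =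
     mat (length es) (length es) (\<lambda>(i, j). ricci_entry E (es ! i) (es ! j))"

(* Only meaningful for symmetric matrices of positive dimension: lambda_max_symmetric. *)
definition lambda_max :: "real mat \<Rightarrow> real" where
  "lambda_max A = Max (spectrum A)"

lemma ricci_entry_diag:
  assumes "x \<noteq> y"
  shows "ricci_entry E {x, y} {x, y} = - (1 / real (vertex_degree E x) + 1 / real (vertex_degree E y))"
  using assms by (simp add: ricci_entry_def)

lemma ricci_entry_adjacent:
  assumes "e \<noteq> e'" "e \<inter> e' = {z}"
  shows "ricci_entry E e e' = 1 / real (vertex_degree E z)"
  using assms by (simp add: ricci_entry_def)

lemma ricci_entry_disjoint:
  assumes "e \<noteq> e'" "e \<inter> e' = {}"
  shows "ricci_entry E e e' = 0"
  using assms by (simp add: ricci_entry_def)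

lemma ricci_matrix_carrier: "ricci_matrix E es \<in> carrier_mat (length es) (length es)"
  by (simp add: ricci_matrix_def)

lemma symmetric_ricci_matrix: "transpose_mat (ricci_matrix E es) = ricci_matrix E es"
  by (rule eq_matI) (auto simp: ricci_matrix_def ricci_entry_def Int_commute)

lemma eigenvalue_ricci_matrix_iff:
  assumes "distinct es" "set es = E"
  shows "eigenvalue (ricci_matrix E es) k \<longleftrightarrow>
    (\<exists>f. (\<exists>e\<in>E. f e \<noteq> 0) \<and>
         (\<forall>e\<in>E. (\<Sum>e'\<in>E. ricci_entry E e e' * f e') = k * f e))"
proof
  let ?n = "length es"
  have bij: "bij_betw ((!) es) {0..<?n} E"
    using assms by (metis atLeast0LessThan bij_betw_nth)
  have sum_eq: "(\<Sum>e'\<in>E. g e') = (\<Sum>j = 0..<?n. g (es ! j))" for g :: "'a set \<Rightarrow> real"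
    using sum.reindex_bij_betw[OF bij, of g] by simp
  {
    assume "eigenvalue (ricci_matrix E es) k"
    then obtain v where v: "v \<in> carrier_vec ?n" "v \<noteq> 0\<^sub>v ?n"
      "ricci_matrix E es *\<^sub>v v = k \<cdot>\<^sub>v v"
      unfolding eigenvalue_def eigenvector_def using ricci_matrix_carrier[of E es] by auto
    define f where "f e = v $ (the_inv_into {0..<?n} ((!) es) e)" for e
    have f: "f (es ! i) = v $ i" if "i < ?n" for i
      unfolding f_def using bij that
      by (simp add: bij_betw_def the_inv_into_f_f)
    have "\<exists>i<?n. v $ i \<noteq> 0" using v(1,2) by (metis carrier_vecD eq_vecI index_zero_vec)
    then have "\<exists>e\<in>E. f e \<noteq> 0" using f assms(2) by (metis nth_mem)
    moreover have "(\<Sum>e'\<in>E. ricci_entry E e e' * f e') = k * f e" if "e \<in> E" for e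
    proof -
      obtain i where i: "i < ?n" "e = es ! i"
        using \<open>e \<in> E\<close> assms(2) in_set_conv_nth[of e es] by auto
      have "(ricci_matrix E es *\<^sub>v v) $ i = k * v $ i" using v i by simp
      moreover have "(ricci_matrix E es *\<^sub>v v) $ i =
          (\<Sum>j = 0..<?n. ricci_entry E (es ! i) (es ! j) * v $ j)"
        using i v(1) by (simp add: ricci_matrix_def scalar_prod_def)
      ultimately show ?thesis using i f by (simp add: sum_eq)
    qed
    ultimately show "\<exists>f. (\<exists>e\<in>E. f e \<noteq> 0) \<and>
         (\<forall>e\<in>E. (\<Sum>e'\<in>E. ricci_entry E e e' * f e') = k * f e)" by blast
  }
  {
    assume "\<exists>f. (\<exists>e\<in>E. f e \<noteq> 0) \<and>
         (\<forall>e\<in>E. (\<Sum>e'\<in>E. ricci_entry E e e' * f e') = k * f e)"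
    then obtain f where f: "\<exists>e\<in>E. f e \<noteq> 0"
      "\<And>e. e \<in> E \<Longrightarrow> (\<Sum>e'\<in>E. ricci_entry E e e' * f e') = k * f e" by blast
    define v where "v = vec ?n (\<lambda>i. f (es ! i))"
    obtain i where i: "i < ?n" "f (es ! i) \<noteq> 0"
      using f(1) assms(2) by (auto simp: in_set_conv_nth)
    have "v $ i \<noteq> 0\<^sub>v ?n $ i" using i by (simp add: v_def)
    then have nz: "v \<noteq> 0\<^sub>v ?n" by metis
    have "ricci_matrix E es *\<^sub>v v = k \<cdot>\<^sub>v v"
    proof (rule eq_vecI)
      fix i assume "i < dim_vec (k \<cdot>\<^sub>v v)"
      then have i: "i < ?n" by (simp add: v_def)
      then have "es ! i \<in> E" using assms(2) by auto
      from f(2)[OF this] show "(ricci_matrix E es *\<^sub>v v) $ i = (k \<cdot>\<^sub>v v) $ i"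
        using i by (simp add: ricci_matrix_def scalar_prod_def v_def sum_eq)
    qed (simp add: ricci_matrix_def v_def)
    then show "eigenvalue (ricci_matrix E es) k"
      unfolding eigenvalue_def eigenvector_def using nz
      by (intro exI[of _ v]) (simp add: ricci_matrix_def v_def)
  }
qed

lemma spectrum_symmetric_nonempty:
  fixes A :: "real mat"
  assumes A: "A \<in> carrier_mat n n" and n: "n > 0" and sym: "transpose_mat A = A"
  shows "spectrum A \<noteq> {}"
proof -
  let ?C = "map_mat complex_of_real A"
  have C: "?C \<in> carrier_mat n n" using A by simp
  obtain k where k: "eigenvalue ?C k"
    using spectrum_non_empty[OF C n] unfolding spectrum_def by auto
  then obtain v where v: "v \<in> carrier_vec n" "v \<noteq> 0\<^sub>v n" "?C *\<^sub>v v = k \<cdot>\<^sub>v v"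
    unfolding eigenvalue_def eigenvector_def using A by auto
  have row: "(\<Sum>j = 0..<n. complex_of_real (A $$ (i, j)) * v $ j) = k * v $ i" if "i < n" for i
  proof -
    have "(?C *\<^sub>v v) $ i = k * v $ i" using v that by simp
    then show ?thesis using A v(1) that by (simp add: scalar_prod_def)
  qed
  have Asym: "A $$ (i, j) = A $$ (j, i)" if "i < n" "j < n" for i j
    using A sym that by (metis carrier_matD index_transpose_mat(1))
  define s where "s = (\<Sum>i = 0..<n. v $ i * cnj (v $ i))"
  have "k * s = (\<Sum>i = 0..<n. (\<Sum>j = 0..<n. complex_of_real (A $$ (i, j)) * v $ j) * cnj (v $ i))"
    unfolding s_def sum_distrib_left by (rule sum.cong) (simp_all add: row)
  also have "\<dots> = (\<Sum>j = 0..<n. v $ j * (\<Sum>i = 0..<n. complex_of_real (A $$ (i, j)) * cnj (v $ i)))"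
    unfolding sum_distrib_left sum_distrib_right
    by (subst sum.swap) (simp add: mult_ac)
  also have "\<dots> = (\<Sum>j = 0..<n. v $ j * cnj (\<Sum>i = 0..<n. complex_of_real (A $$ (j, i)) * v $ i))"
    by (rule sum.cong) (auto simp: Asym intro!: sum.cong)
  also have "\<dots> = cnj k * s"
    unfolding s_def sum_distrib_left by (rule sum.cong) (simp_all add: row del: cnj_sum)
  finally have ks: "k * s = cnj k * s" .
  obtain i where i: "i < n" "v $ i \<noteq> 0"
    using v(1,2) by (metis carrier_vecD eq_vecI index_zero_vec)
  have s: "s = complex_of_real (\<Sum>i = 0..<n. (cmod (v $ i))\<^sup>2)"
    unfolding s_def of_real_sum complex_norm_square ..
  have "(\<Sum>i = 0..<n. (cmod (v $ i))\<^sup>2) > 0"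
    by (rule sum_pos2[of _ i]) (use i in auto)
  then have "s \<noteq> 0" unfolding s by (simp del: of_real_sum)
  with ks have "k = cnj k" by simp
  then obtain r where r: "k = complex_of_real r" by (metis Reals_cases Reals_cnj_iff)
  have "poly (char_poly ?C) k = 0" using k eigenvalue_root_char_poly[OF C] by simp
  then have "poly (char_poly A) r = 0"
    unfolding r of_real_hom.char_poly_hom[OF A] by simp
  then show ?thesis unfolding spectrum_root_char_poly[OF A] by auto
qed

lemma lambda_max_symmetric:
  fixes A :: "real mat"
  assumes A: "A \<in> carrier_mat n n" and n: "n > 0" and sym: "transpose_mat A = A"
  shows "eigenvalue A (lambda_max A)" and "eigenvalue A k \<Longrightarrow> k \<le> lambda_max A"
  using Max_in[OF card_finite_spectrum(1)[OF A] spectrum_symmetric_nonempty[OF assms]]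
    Max_ge[OF card_finite_spectrum(1)[OF A], of k]
  by (auto simp: lambda_max_def spectrum_def)

end

theory Submission
  imports Defs "HOL-Analysis.Convex"
begin

text \<open>
  A connected graph with as many edges as vertices can be oriented so that every vertex has exactly
  one outgoing edge. The quadratic form of the Ricci matrix is a sum of vertex contributions
  \<open>((\<Sum>e\<ni>v. f e)\<^sup>2 - 2 (\<Sum>e\<ni>v. (f e)\<^sup>2)) / d\<^sub>v\<close>. Suppose that each of them is at most
  \<open>\<alpha> (f e)\<^sup>2\<close> for the outgoing edge plus \<open>\<beta> (f e)\<^sup>2\<close> for the incoming edges. Every edge is outgoing at
  one end and incoming at the other, so \<open>\<alpha> + \<beta>\<close> bounds the eigenvalues. By Cauchy-Schwarz the
  vertex bound amounts to a quadratic inequality in \<open>d\<^sub>v\<close>, and the \<open>\<alpha>\<close>, \<open>\<beta>\<close> that are optimal for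
  degree \<open>min \<D> 19\<close> satisfy it for all integers \<open>d\<^sub>v\<close> that occur.
\<close>

section \<open>Spanning trees and the orientation\<close>

text \<open>Breadth-first tree: \<open>p v\<close> leads from \<open>v\<close> to a neighbour
  strictly closer to \<open>r\<close>. An edge chosen by both its ends would make each end closer
  than the other, hence injectivity. The last conclusion makes the tree itself connected, so that it
  can be given another root.\<close>

lemma connected_graph_parent_edges:
  assumes conn: "connected_graph V E" and sub: "\<And>e. e \<in> E \<Longrightarrow> e \<subseteq> V" and r: "r \<in> V"
  obtains p where "\<And>v. v \<in> V - {r} \<Longrightarrow> p v \<in> E \<and> v \<in> p v" "inj_on p (V - {r})"
    "\<And>v. v \<in> V \<Longrightarrow> (v, r) \<in> {(x, y). {x, y} \<in> p ` (V - {r})}\<^sup>*"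
proof -
  let ?R = "{(x, y). {x, y} \<in> E}"
  define dist where "dist v = (LEAST n. (v, r) \<in> ?R ^^ n)" for v
  have "\<exists>u. {v, u} \<in> E \<and> dist u < dist v \<and> (u, r) \<in> ?R\<^sup>*" if v: "(v, r) \<in> ?R\<^sup>*" "v \<noteq> r" for v
  proof -
    obtain n where "(v, r) \<in> ?R ^^ n" using v by (meson rtrancl_imp_relpow)
    then have d: "(v, r) \<in> ?R ^^ dist v" unfolding dist_def by (rule LeastI)
    with \<open>v \<noteq> r\<close> have "dist v \<noteq> 0" by (metis relpow_0_E)
    then obtain m where m: "dist v = Suc m" by (metis not0_implies_Suc)
    with d obtain u where u: "(v, u) \<in> ?R" "(u, r) \<in> ?R ^^ m" by (metis relpow_Suc_D2)
    have "dist u \<le> m" unfolding dist_def using u(2) by (rule Least_le)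
    then show ?thesis using u m by (auto intro: relpow_imp_rtrancl)
  qed
  then obtain u where u: "\<And>v. (v, r) \<in> ?R\<^sup>* \<Longrightarrow> v \<noteq> r \<Longrightarrow>
      {v, u v} \<in> E \<and> dist (u v) < dist v \<and> (u v, r) \<in> ?R\<^sup>*"
    by metis
  have reach: "(v, r) \<in> ?R\<^sup>*" if "v \<in> V" for v
    using conn r that by (auto simp: connected_graph_def)
  define p where "p v = {v, u v}" for v
  show ?thesis
  proof (rule that)
    show "p v \<in> E \<and> v \<in> p v" if "v \<in> V - {r}" for v
      using u[OF reach] that by (auto simp: p_def)
    show "inj_on p (V - {r})"
    proof (rule inj_onI)
      fix v w assume vw: "v \<in> V - {r}" "w \<in> V - {r}" "p v = p w"
      then have "dist (u v) < dist v" "dist (u w) < dist w"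
        using u[OF reach] by auto
      then show "v = w" using vw(3) by (auto simp: p_def doubleton_eq_iff)
    qed
    show "(v, r) \<in> {(x, y). {x, y} \<in> p ` (V - {r})}\<^sup>*" if "v \<in> V" for v
      using that
    proof (induction "dist v" arbitrary: v rule: less_induct)
      case less
      show ?case
      proof (cases "v = r")
        case False
        note uv = u[OF reach[OF less.prems] False]
        then have "u v \<in> V" using sub by blast
        then have "(u v, r) \<in> {(x, y). {x, y} \<in> p ` (V - {r})}\<^sup>*" using less.hyps uv by blast
        moreover have "{v, u v} \<in> p ` (V - {r})" using False less.prems by (auto simp: p_def)
        ultimately show ?thesis by (auto intro: converse_rtrancl_into_rtrancl)
      qed simp
    qed
  qed
qed

text \<open>A spanning tree has one edge fewer than \<open>E\<close>, so an edge
  \<open>e\<^sub>0\<close> is left over. With the tree re-rooted at an end \<open>a\<close> of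
  \<open>e\<^sub>0\<close>, every other vertex takes its parent edge and \<open>a\<close> takes
  \<open>e\<^sub>0\<close>.\<close>

lemma unicyclic_orientation:
  assumes "unicyclic V E"
  obtains out where "bij_betw out V E" "\<And>v. v \<in> V \<Longrightarrow> v \<in> out v"
proof -
  have fin: "finite V" and sub: "\<And>e. e \<in> E \<Longrightarrow> e \<subseteq> V" and c2: "\<And>e. e \<in> E \<Longrightarrow> card e = 2"
    and conn: "connected_graph V E" and card: "card E = card V"
    using assms by (auto simp: unicyclic_def simple_graph_def)
  obtain r where r: "r \<in> V" using conn by (auto simp: connected_graph_def)
  obtain p where p: "\<And>v. v \<in> V - {r} \<Longrightarrow> p v \<in> E \<and> v \<in> p v"
      and inj: "inj_on p (V - {r})"
      and reach: "\<And>v. v \<in> V \<Longrightarrow> (v, r) \<in> {(x, y). {x, y} \<in> p ` (V - {r})}\<^sup>*"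
    using connected_graph_parent_edges[OF conn sub r] by blast
  let ?T = "p ` (V - {r})"
  have "card ?T = card V - 1" using card_image[OF inj] fin r by simp
  \<comment> \<open>Positivity makes the truncated \<open>card V - 1\<close> strictly smaller than
    \<open>card E\<close>.\<close>
  moreover have "card V > 0" using fin r by (auto simp: card_gt_0_iff)
  ultimately have "\<not> E \<subseteq> ?T" using card fin card_mono[of ?T E] by auto
  then obtain e\<^sub>0 where e0: "e\<^sub>0 \<in> E" "e\<^sub>0 \<notin> ?T" by blast
  then obtain a where a: "a \<in> e\<^sub>0" using c2[of e\<^sub>0] by fastforce
  then have aV: "a \<in> V" using e0 sub by blast
  let ?S = "{(x, y). {x, y} \<in> ?T}"
  have "sym (?S\<^sup>*)" by (rule sym_rtrancl) (auto simp: sym_def insert_commute)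
  then have connT: "connected_graph V ?T"
    using r reach unfolding connected_graph_def by (metis (no_types, lifting) empty_iff rtrancl_trans symD)
  have subT: "e \<subseteq> V" if "e \<in> ?T" for e using that p sub by blast
  \<comment> \<open>The second search runs inside the tree, so its parent edges all differ from
    \<open>e\<^sub>0\<close>.\<close>
  obtain q where q: "\<And>v. v \<in> V - {a} \<Longrightarrow> q v \<in> ?T \<and> v \<in> q v" and injq: "inj_on q (V - {a})"
    by (rule connected_graph_parent_edges[OF connT subT aV], assumption, rule that)
  define out where "out = q(a := e\<^sub>0)"
  have "inj_on out V"
    unfolding out_def
  proof (rule inj_onI)
    fix v w assume vw: "v \<in> V" "w \<in> V" "(q(a := e\<^sub>0)) v = (q(a := e\<^sub>0)) w"
    show "v = w"
    proof (cases "v = a \<or> w = a")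
      case True
      then show ?thesis using vw q[of v] q[of w] e0(2) by (auto split: if_splits)
    next
      case False
      then show ?thesis using vw injq by (auto dest: inj_onD)
    qed
  qed
  moreover have "?T \<subseteq> E" using p by blast
  then have "out ` V \<subseteq> E" using q e0(1) unfolding out_def by fastforce
  moreover have "finite E" using sub fin by (meson finite_Pow_iff finite_subset Pow_iff subsetI)
  ultimately have "bij_betw out V E"
    unfolding bij_betw_def using card by (metis card_image card_subset_eq)
  then show ?thesis by (rule that) (use q a in \<open>auto simp: out_def\<close>)
qed

section \<open>The inequality at a single vertex\<close>

text \<open>Weighted Cauchy-Schwarz: \<open>ab\<close> is \<open>1/a + m/b \<le> 1\<close> cleared
  of denominators.\<close>

lemma square_add_le_weighted:
  fixes x T Q a b m :: real
  assumes "m > 0" "a > 1" and ab: "a * b \<ge> b + m * a" and CS: "T\<^sup>2 \<le> m * Q" and b: "b \<ge> 0"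
  shows "(x + T)\<^sup>2 \<le> a * x\<^sup>2 + b * Q"
proof -
  have "(a - 1) * (b - m) - m \<ge> 0" using ab by (simp add: algebra_simps)
  \<comment> \<open>The square vanishes in the equality case \<open>T = (a - 1) * x\<close>; the
    condition on \<open>a\<close> and \<open>b\<close> makes the coefficient of the remaining
    \<open>T\<^sup>2\<close> nonnegative.\<close>
  then have "0 \<le> m * ((a - 1) * x - T)\<^sup>2 + ((a - 1) * (b - m) - m) * T\<^sup>2"
    using \<open>m > 0\<close> by simp
  also have "\<dots> = (a - 1) * (m * (a * x\<^sup>2 - (x + T)\<^sup>2) + b * T\<^sup>2)"
    by (simp add: power2_eq_square algebra_simps)
  finally have "0 \<le> m * (a * x\<^sup>2 - (x + T)\<^sup>2) + b * T\<^sup>2"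
    using \<open>a > 1\<close> by (simp add: zero_le_mult_iff)
  also have "\<dots> \<le> m * (a * x\<^sup>2 - (x + T)\<^sup>2) + b * (m * Q)"
    using CS b by (simp add: mult_left_mono)
  also have "\<dots> = m * (a * x\<^sup>2 + b * Q - (x + T)\<^sup>2)" by (simp add: algebra_simps)
  finally show ?thesis using \<open>m > 0\<close> by (simp add: zero_le_mult_iff)
qed

lemma sum_square_le_weighted:
  fixes f :: "'b \<Rightarrow> real"
  assumes A: "finite A" "i \<in> A" and "a > 1" "b \<ge> 0"
    and ab: "a * b \<ge> b + (real (card A) - 1) * a"
  shows "(\<Sum>j\<in>A. f j)\<^sup>2 \<le> a * (f i)\<^sup>2 + b * (\<Sum>j\<in>A - {i}. (f j)\<^sup>2)"
proof (cases "A = {i}")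
  \<comment> \<open>At a leaf there are no incoming edges; \<open>m = 0\<close> is outside the scope
    of \<open>square_add_le_weighted\<close>.\<close>
  case True
  have "(f i)\<^sup>2 \<le> a * (f i)\<^sup>2" using \<open>a > 1\<close> by (simp add: mult_le_cancel_right1)
  then show ?thesis using True by simp
next
  case False
  let ?B = "A - {i}"
  have m: "real (card ?B) = real (card A) - 1"
    using A card_gt_0_iff[of A] by (auto simp: of_nat_diff)
  have "?B \<noteq> {}" using False A by auto
  then have "real (card ?B) > 0" using A(1) by (simp only: of_nat_0_less_iff card_gt_0_iff finite_Diff simp_thms)
  moreover have "(\<Sum>j\<in>?B. f j)\<^sup>2 \<le> real (card ?B) * (\<Sum>j\<in>?B. (f j)\<^sup>2)"
    using sum_squared_le_sum_of_squares[of f ?B] by (simp add: mult.commute)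
  ultimately show ?thesis
    using square_add_le_weighted[of "real (card ?B)" a b "\<Sum>j\<in>?B. f j" "\<Sum>j\<in>?B. (f j)\<^sup>2" "f i"]
      assms m sum.remove[OF A, of f] by simp
qed

section \<open>The quadratic form as a sum over vertices\<close>

text \<open>A single formula for all three kinds of entries, split by vertex: the numerator is 1 - 2
  = -1 at both ends on the diagonal, and otherwise 1 only at a common vertex, which is unique for
  distinct edges.\<close>

lemma ricci_entry_eq_sum:
  assumes "card e = 2" "card e' = 2"
  shows "ricci_entry E e e' =
    (\<Sum>v\<in>e. (of_bool (v \<in> e') - 2 * of_bool (e = e')) / real (vertex_degree E v))"
proof (cases "e = e'")
  case True
  then show ?thesis by (simp add: ricci_entry_def sum_negf[symmetric] cong: sum.cong)
next
  case False
  have fin: "finite e" "finite e'" using assms by (metis card.infinite zero_neq_numeral)+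
  have "e \<inter> e' \<noteq> e" using False card_subset_eq[OF fin(2), of e] assms by auto
  then have "card (e \<inter> e') < 2" using psubset_card_mono[OF fin(1), of "e \<inter> e'"] assms by auto
  then have "card (e \<inter> e') = 0 \<or> card (e \<inter> e') = Suc 0" by linarith
  then have "e \<inter> e' = {} \<or> (\<exists>z. e \<inter> e' = {z})"
    using fin by (simp add: card_1_singleton_iff)
  then have "ricci_entry E e e' = (\<Sum>v\<in>e \<inter> e'. 1 / real (vertex_degree E v))"
    using False by (elim disjE exE) (simp_all add: ricci_entry_def)
  also have "\<dots> = (\<Sum>v\<in>e. (of_bool (v \<in> e') - 2 * of_bool (e = e')) / real (vertex_degree E v))"
    using fin False by (intro sum.mono_neutral_cong_left) auto
  finally show ?thesis .
qed

text \<open>With b the 0-1 incidence vector of \<open>v\<close>, the matrix is the sum over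
  \<open>v\<close> of (b b^T - 2 diag b) / d. Indicators extend all sums to \<open>V\<close> and
  \<open>E\<close>, so that their order can be exchanged.\<close>

lemma ricci_quadratic_form:
  fixes f :: "'a set \<Rightarrow> real"
  assumes "simple_graph V E"
  shows "(\<Sum>e\<in>E. f e * (\<Sum>e'\<in>E. ricci_entry E e e' * f e')) =
    (\<Sum>v\<in>V. ((\<Sum>e | e \<in> E \<and> v \<in> e. f e)\<^sup>2 - 2 * (\<Sum>e | e \<in> E \<and> v \<in> e. (f e)\<^sup>2))
      / real (vertex_degree E v))"
proof -
  have fin: "finite V" and sub: "\<And>e. e \<in> E \<Longrightarrow> e \<subseteq> V" and c2: "\<And>e. e \<in> E \<Longrightarrow> card e = 2"
    using assms by (auto simp: simple_graph_def)
  have finE: "finite E" using sub fin by (meson finite_Pow_iff finite_subset Pow_iff subsetI)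
  let ?d = "\<lambda>v. real (vertex_degree E v)"
  have E: "(\<Sum>e | e \<in> E \<and> v \<in> e. g e) = (\<Sum>e\<in>E. of_bool (v \<in> e) * g e)"
    for v and g :: "'a set \<Rightarrow> real"
    using finE by (intro sum.mono_neutral_cong_left) auto
  have "(\<Sum>e\<in>E. f e * (\<Sum>e'\<in>E. ricci_entry E e e' * f e')) =
      (\<Sum>e\<in>E. \<Sum>e'\<in>E. \<Sum>v\<in>V. of_bool (v \<in> e) * f e * f e' *
        (of_bool (v \<in> e') - 2 * of_bool (e = e')) / ?d v)"
    unfolding sum_distrib_left
  proof (intro sum.cong refl)
    fix e e' assume e: "e \<in> E" "e' \<in> E"
    have "f e * (ricci_entry E e e' * f e') =
        (\<Sum>v\<in>e. f e * f e' * (of_bool (v \<in> e') - 2 * of_bool (e = e')) / ?d v)"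
      using e c2 by (simp add: ricci_entry_eq_sum sum_distrib_left sum_distrib_right mult_ac)
    also have "\<dots> = (\<Sum>v\<in>V. of_bool (v \<in> e) * f e * f e' *
        (of_bool (v \<in> e') - 2 * of_bool (e = e')) / ?d v)"
      using fin sub e by (intro sum.mono_neutral_cong_left) auto
    finally show "f e * (ricci_entry E e e' * f e') = \<dots>" .
  qed
  also have "\<dots> = (\<Sum>v\<in>V. \<Sum>e\<in>E. \<Sum>e'\<in>E. of_bool (v \<in> e) * f e * f e' *
        (of_bool (v \<in> e') - 2 * of_bool (e = e')) / ?d v)"
    by (subst (2) sum.swap, subst sum.swap) simp
  also have "\<dots> = (\<Sum>v\<in>V. ((\<Sum>e | e \<in> E \<and> v \<in> e. f e)\<^sup>2
      - 2 * (\<Sum>e | e \<in> E \<and> v \<in> e. (f e)\<^sup>2)) / ?d v)"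
  proof (intro sum.cong refl)
    fix v
    have "(\<Sum>e\<in>E. \<Sum>e'\<in>E. of_bool (v \<in> e) * f e * f e' *
          (of_bool (v \<in> e') - 2 * of_bool (e = e'))) =
        (\<Sum>e\<in>E. \<Sum>e'\<in>E. (of_bool (v \<in> e) * f e) * (of_bool (v \<in> e') * f e')) -
        (\<Sum>e\<in>E. \<Sum>e'\<in>E. if e = e' then 2 * (of_bool (v \<in> e) * (f e)\<^sup>2) else 0)"
      unfolding sum_subtractf[symmetric]
      by (intro sum.cong) (auto simp: algebra_simps power2_eq_square)
    also have "\<dots> = (\<Sum>e\<in>E. of_bool (v \<in> e) * f e)\<^sup>2 - 2 * (\<Sum>e\<in>E. of_bool (v \<in> e) * (f e)\<^sup>2)"
      using finE unfolding power2_eq_square[of "sum _ _"] sum_product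
      by (simp add: sum_distrib_left del: sum_of_bool_mult_eq)
    finally show "(\<Sum>e\<in>E. \<Sum>e'\<in>E. of_bool (v \<in> e) * f e * f e' *
          (of_bool (v \<in> e') - 2 * of_bool (e = e')) / ?d v) =
        ((\<Sum>e | e \<in> E \<and> v \<in> e. f e)\<^sup>2 - 2 * (\<Sum>e | e \<in> E \<and> v \<in> e. (f e)\<^sup>2)) / ?d v"
      unfolding E by (simp add: sum_divide_distrib[symmetric])
  qed
  finally show ?thesis .
qed

text \<open>The condition \<open>deg\<close> is that of \<open>sum_square_le_weighted\<close> for
  the weights \<open>d * \<alpha> + 2\<close> and \<open>d * \<beta> + 2\<close>: the factor
  \<open>d\<close> cancels the division by the degree, and the 2 absorbs the subtracted
  squares.\<close>

lemma ricci_quadratic_form_le: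
  fixes f :: "'a set \<Rightarrow> real"
  assumes uni: "unicyclic V E" and nn: "\<alpha> \<ge> 0" "\<beta> \<ge> 0"
    and deg: "\<And>v. v \<in> V \<Longrightarrow> let d = real (vertex_degree E v) in
      (d * \<alpha> + 2) * (d * \<beta> + 2) \<ge> (d * \<beta> + 2) + (d - 1) * (d * \<alpha> + 2)"
  shows "(\<Sum>e\<in>E. f e * (\<Sum>e'\<in>E. ricci_entry E e e' * f e')) \<le> (\<alpha> + \<beta>) * (\<Sum>e\<in>E. (f e)\<^sup>2)"
proof -
  have simple: "simple_graph V E" using uni by (simp add: unicyclic_def)
  have fin: "finite V" and sub: "\<And>e. e \<in> E \<Longrightarrow> e \<subseteq> V" and c2: "\<And>e. e \<in> E \<Longrightarrow> card e = 2"
    using simple by (auto simp: simple_graph_def)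
  have finE: "finite E" using sub fin by (meson finite_Pow_iff finite_subset Pow_iff subsetI)
  obtain out where bij: "bij_betw out V E" and out: "\<And>v. v \<in> V \<Longrightarrow> v \<in> out v"
    using unicyclic_orientation[OF uni] by blast
  let ?I = "\<lambda>v. {e \<in> E. v \<in> e}"
  have "(\<Sum>e\<in>E. f e * (\<Sum>e'\<in>E. ricci_entry E e e' * f e')) =
      (\<Sum>v\<in>V. ((\<Sum>e\<in>?I v. f e)\<^sup>2 - 2 * (\<Sum>e\<in>?I v. (f e)\<^sup>2)) / real (vertex_degree E v))"
    by (rule ricci_quadratic_form[OF simple])
  \<comment> \<open>Giving all incident edges the weight \<open>\<beta>\<close> and correcting the
    outgoing one by \<open>\<alpha> - \<beta>\<close> leaves two sums that can be reindexed over
    \<open>E\<close>.\<close>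
  also have "\<dots> \<le> (\<Sum>v\<in>V. (\<alpha> - \<beta>) * (f (out v))\<^sup>2 + \<beta> * (\<Sum>e\<in>?I v. (f e)\<^sup>2))"
  proof (rule sum_mono)
    fix v assume v: "v \<in> V"
    define d where "d = real (vertex_degree E v)"
    have A: "finite (?I v)" "out v \<in> ?I v"
      using finE out bij v by (auto simp: bij_betw_def)
    then have d: "d = real (card (?I v))" "d > 0"
      by (auto simp: d_def vertex_degree_def card_gt_0_iff)
    have "(\<Sum>e\<in>?I v. f e)\<^sup>2 \<le>
        (d * \<alpha> + 2) * (f (out v))\<^sup>2 + (d * \<beta> + 2) * (\<Sum>e\<in>?I v - {out v}. (f e)\<^sup>2)"
      using A nn d deg[OF v] by (intro sum_square_le_weighted) (auto simp: Let_def d_def add_pos_nonneg)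
    also have "(\<Sum>e\<in>?I v - {out v}. (f e)\<^sup>2) = (\<Sum>e\<in>?I v. (f e)\<^sup>2) - (f (out v))\<^sup>2"
      using A by (simp add: sum_diff1)
    finally have "(\<Sum>e\<in>?I v. f e)\<^sup>2 - 2 * (\<Sum>e\<in>?I v. (f e)\<^sup>2) \<le>
        d * ((\<alpha> - \<beta>) * (f (out v))\<^sup>2 + \<beta> * (\<Sum>e\<in>?I v. (f e)\<^sup>2))"
      by (simp add: algebra_simps)
    then show "((\<Sum>e\<in>?I v. f e)\<^sup>2 - 2 * (\<Sum>e\<in>?I v. (f e)\<^sup>2)) / real (vertex_degree E v) \<le>
        (\<alpha> - \<beta>) * (f (out v))\<^sup>2 + \<beta> * (\<Sum>e\<in>?I v. (f e)\<^sup>2)"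
      using d by (simp add: d_def[symmetric] pos_divide_le_eq mult.commute)
  qed
  also have "\<dots> = (\<alpha> - \<beta>) * (\<Sum>v\<in>V. (f (out v))\<^sup>2) + \<beta> * (\<Sum>v\<in>V. \<Sum>e\<in>?I v. (f e)\<^sup>2)"
    by (simp add: sum.distrib sum_distrib_left)
  also have "(\<Sum>v\<in>V. (f (out v))\<^sup>2) = (\<Sum>e\<in>E. (f e)\<^sup>2)"
    by (rule sum.reindex_bij_betw[OF bij])
  also have "(\<Sum>v\<in>V. \<Sum>e\<in>?I v. (f e)\<^sup>2) = (\<Sum>e\<in>E. \<Sum>v | v \<in> V \<and> v \<in> e. (f e)\<^sup>2)"
    using fin finE by (rule sum.swap_restrict)
  \<comment> \<open>Each edge is counted at both ends, so the total weight is
    \<open>(\<alpha> - \<beta>) + 2 * \<beta>\<close>.\<close>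
  also have "\<dots> = (\<Sum>e\<in>E. 2 * (f e)\<^sup>2)"
  proof (rule sum.cong[OF refl])
    fix e assume e: "e \<in> E"
    then have "{v. v \<in> V \<and> v \<in> e} = e" using sub by auto
    then show "(\<Sum>v | v \<in> V \<and> v \<in> e. (f e)\<^sup>2) = 2 * (f e)\<^sup>2" using c2[OF e] by simp
  qed
  finally show ?thesis by (simp add: sum_distrib_left[symmetric] algebra_simps)
qed

section \<open>Bounds on the largest eigenvalue\<close>

text \<open>The Rayleigh quotient of an eigenvector for \<open>lambda_max\<close> equals that
  eigenvalue.\<close>

lemma lambda_max_ricci_le:
  assumes uni: "unicyclic V E" and es: "distinct es" "set es = E" and nn: "\<alpha> \<ge> 0" "\<beta> \<ge> 0"
    and deg: "\<And>v. v \<in> V \<Longrightarrow> let d = real (vertex_degree E v) in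
      (d * \<alpha> + 2) * (d * \<beta> + 2) \<ge> (d * \<beta> + 2) + (d - 1) * (d * \<alpha> + 2)"
  shows "lambda_max (ricci_matrix E es) \<le> \<alpha> + \<beta>"
proof -
  let ?l = "lambda_max (ricci_matrix E es)"
  have "card V > 0" "card E = card V"
    using uni by (auto simp: unicyclic_def simple_graph_def connected_graph_def card_gt_0_iff)
  then have "length es > 0" using es by auto
  then have "eigenvalue (ricci_matrix E es) ?l"
    by (rule lambda_max_symmetric(1)[OF ricci_matrix_carrier _ symmetric_ricci_matrix])
  then obtain f where f: "\<exists>e\<in>E. f e \<noteq> 0"
      "\<And>e. e \<in> E \<Longrightarrow> (\<Sum>e'\<in>E. ricci_entry E e e' * f e') = ?l * f e"
    unfolding eigenvalue_ricci_matrix_iff[OF es] by blast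
  have "?l * (\<Sum>e\<in>E. (f e)\<^sup>2) = (\<Sum>e\<in>E. f e * (\<Sum>e'\<in>E. ricci_entry E e e' * f e'))"
    unfolding sum_distrib_left[of ?l] by (intro sum.cong) (simp_all add: f(2) power2_eq_square)
  also have "\<dots> \<le> (\<alpha> + \<beta>) * (\<Sum>e\<in>E. (f e)\<^sup>2)"
    by (rule ricci_quadratic_form_le[OF uni nn deg])
  finally have le: "?l * (\<Sum>e\<in>E. (f e)\<^sup>2) \<le> (\<alpha> + \<beta>) * (\<Sum>e\<in>E. (f e)\<^sup>2)" .
  obtain e where "e \<in> E" "f e \<noteq> 0" using f(1) by blast
  then have "(\<Sum>e\<in>E. (f e)\<^sup>2) > 0" using es(2) by (intro sum_pos2[of _ e]) auto
  then show ?thesis using le by simp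
qed

text \<open>
  The weights minimise \<open>\<alpha> + \<beta>\<close> under the vertex inequality of degree \<open>d = s\<^sup>2 + 1\<close>, where it is
  tight. Hence the difference of its two sides is divisible by \<open>d - (s\<^sup>2 + 1)\<close>.
\<close>

lemma lambda_max_ricci_le_root:
  assumes uni: "unicyclic V E" and es: "distinct es" "set es = E" and s: "s \<ge> 1"
    and deg: "\<And>v. v \<in> V \<Longrightarrow> let d = real (vertex_degree E v) in
      (d - (s\<^sup>2 + 1)) * (d * ((s - 1) * (s - 3)) - 4 * (s\<^sup>2 + 1)) \<ge> 0"
  shows "lambda_max (ricci_matrix E es) \<le> 1 - 4 / (s\<^sup>2 + 1) + 2 * s / (s\<^sup>2 + 1)"
proof -
  let ?N = "s\<^sup>2 + 1"
  \<comment> \<open>For \<open>d = s\<^sup>2 + 1\<close>, the minimum of a + b subject to 1/a +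
    s^2/b = 1 is attained at a = s + 1, b = s (s + 1). Solving \<open>d * \<alpha> + 2\<close> = a
    and \<open>d * \<beta> + 2\<close> = b gives these values.\<close>
  define \<alpha> where "\<alpha> = (s - 1) / ?N"
  define \<beta> where "\<beta> = (s\<^sup>2 + s - 2) / ?N"
  have N: "?N > 0" by (simp add: add_nonneg_pos)
  have ss: "s\<^sup>2 + s - 2 \<ge> 0" using s one_le_power[OF s, of 2] by linarith
  have nn: "\<alpha> \<ge> 0" "\<beta> \<ge> 0"
    unfolding \<alpha>_def \<beta>_def using s ss N by (auto intro!: divide_nonneg_pos)
  have aN: "\<alpha> * ?N = s - 1" "\<beta> * ?N = s\<^sup>2 + s - 2" using N by (auto simp: \<alpha>_def \<beta>_def)
  have "lambda_max (ricci_matrix E es) \<le> \<alpha> + \<beta>"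
  proof (rule lambda_max_ricci_le[OF uni es nn])
    fix v assume "v \<in> V"
    define d where "d = real (vertex_degree E v)"
    let ?h = "(d * \<alpha> + 2) * (d * \<beta> + 2) - ((d * \<beta> + 2) + (d - 1) * (d * \<alpha> + 2))"
    have "?h * ?N\<^sup>2 = (d * (\<alpha> * ?N) + 2 * ?N) * (d * (\<beta> * ?N) + 2 * ?N)
        - ((d * (\<beta> * ?N) + 2 * ?N) * ?N + (d - 1) * (d * (\<alpha> * ?N) + 2 * ?N) * ?N)"
      by (simp add: power2_eq_square algebra_simps)
    \<comment> \<open>As a quadratic in \<open>d\<close> this vanishes at \<open>?N\<close>; its
      leading coefficient \<open>(s - 1) * (s - 3)\<close> and constant term
      \<open>4 * ?N\<^sup>2\<close> determine the other factor.\<close>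
    also have "\<dots> = (d - ?N) * (d * ((s - 1) * (s - 3)) - 4 * ?N)"
      unfolding aN by (simp add: power2_eq_square algebra_simps)
    finally have "?h * ?N\<^sup>2 \<ge> 0" using deg[OF \<open>v \<in> V\<close>] by (simp add: Let_def d_def)
    then have "?h \<ge> 0" using N by (simp add: zero_le_mult_iff)
    then show "let d = real (vertex_degree E v) in
        (d * \<alpha> + 2) * (d * \<beta> + 2) \<ge> (d * \<beta> + 2) + (d - 1) * (d * \<alpha> + 2)"
      by (simp add: Let_def d_def)
  qed
  also have "\<alpha> + \<beta> = 1 - 4 / ?N + 2 * s / ?N"
    using N by (simp add: \<alpha>_def \<beta>_def field_simps)
  finally show ?thesis .
qed

section \<open>The two ranges of the maximum degree\<close>

theorem theorem5p4:
  fixes V :: "'a set" and E :: "'a set set" and es :: "'a set list"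
  assumes "unicyclic V E"
    and "distinct es" and "set es = E"
  shows "let D = max_degree V E in
      (2 \<le> D \<and> D \<le> 18 \<longrightarrow>
         lambda_max (ricci_matrix E es) \<le> 1 - 4 / real D + 2 * sqrt (real D - 1) / real D) \<and>
      (19 \<le> D \<longrightarrow>
         lambda_max (ricci_matrix E es) \<le> (15 + 6 * sqrt 2) / 19)"
proof -
  define D where "D = max_degree V E"
  have fin: "finite V" using assms(1) by (simp add: unicyclic_def simple_graph_def)
  have dD: "vertex_degree E v \<le> D" if "v \<in> V" for v
    unfolding D_def max_degree_def using fin that by simp
  have small: "lambda_max (ricci_matrix E es) \<le> 1 - 4 / real D + 2 * sqrt (real D - 1) / real D"
    if D: "2 \<le> D" "D \<le> 18"
  proof -
    define s where "s = sqrt (real D - 1)"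
    have s2: "s\<^sup>2 + 1 = real D" and s1: "s \<ge> 1" using D by (auto simp: s_def)
    \<comment> \<open>The target \<open>s4\<close> amounts to D^2 - 20 D + 20 \<le> 0, whose larger
      root 10 + 4 sqrt 5 lies between 18 and 19. The product here is that quadratic plus 16.\<close>
    have "(real D - 2) * (real D - 18) \<le> 0" using D by (intro mult_nonneg_nonpos) auto
    then have "(real D - 2) / 4 \<le> s"
      unfolding s_def by (intro real_le_rsqrt) (simp add: power2_eq_square field_simps)
    then have s4: "(s - 1) * (s - 3) \<le> 4"
      using s2 by (simp add: power2_eq_square algebra_simps)
    have "lambda_max (ricci_matrix E es) \<le> 1 - 4 / (s\<^sup>2 + 1) + 2 * s / (s\<^sup>2 + 1)"
    proof (rule lambda_max_ricci_le_root[OF assms s1])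
      fix v assume "v \<in> V"
      define d where "d = real (vertex_degree E v)"
      have d: "0 \<le> d" "d \<le> real D" using dD[OF \<open>v \<in> V\<close>] by (auto simp: d_def)
      have "d * ((s - 1) * (s - 3)) \<le> d * 4" using d s4 by (intro mult_left_mono)
      then have "d * ((s - 1) * (s - 3)) - 4 * real D \<le> 0" using d by linarith
      then show "let d = real (vertex_degree E v) in
          (d - (s\<^sup>2 + 1)) * (d * ((s - 1) * (s - 3)) - 4 * (s\<^sup>2 + 1)) \<ge> 0"
        using d unfolding s2 Let_def d_def[symmetric] by (intro mult_nonpos_nonpos) auto
    qed
    then show ?thesis unfolding s2 by (simp add: s_def)
  qed
  have large: "lambda_max (ricci_matrix E es) \<le> (15 + 6 * sqrt 2) / 19"
  proof -
    define s where "s = 3 * sqrt 2"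
    have s2: "s\<^sup>2 = 18" by (simp add: s_def power_mult_distrib)
    have "s \<ge> 0" by (simp add: s_def)
    \<comment> \<open>The bound 4.25 is exactly what \<open>19 * (21 - 4 * s) \<ge> 76\<close>
      requires.\<close>
    then have s: "4.24 \<le> s" "s \<le> 4.25"
      using s2 by (auto intro: power2_le_imp_le simp: power2_eq_square)
    have c: "(s - 1) * (s - 3) = 21 - 4 * s" using s2 by (simp add: power2_eq_square algebra_simps)
    have "lambda_max (ricci_matrix E es) \<le> 1 - 4 / (s\<^sup>2 + 1) + 2 * s / (s\<^sup>2 + 1)"
    proof (rule lambda_max_ricci_le_root[OF assms])
      show "s \<ge> 1" using s by simp
      fix v
      let ?d = "real (vertex_degree E v)"
      \<comment> \<open>The second factor changes sign at 76 / (21 - 4 s), about 18.86. No integer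
        lies strictly between this root and 19, so the factors never have opposite signs.\<close>
      have "(?d - 19) * (?d * (21 - 4 * s) - 76) \<ge> 0"
      proof (cases "vertex_degree E v \<le> 18")
        case True
        then have d: "0 \<le> ?d" "?d \<le> 18" by auto
        have "?d * (21 - 4 * s) \<le> 18 * (21 - 4 * s)" using d s by (intro mult_right_mono) auto
        then show ?thesis using d s by (intro mult_nonpos_nonpos) auto
      next
        case False
        then have d: "19 \<le> ?d" by auto
        have "19 * (21 - 4 * s) \<le> ?d * (21 - 4 * s)" using d s by (intro mult_right_mono) auto
        then show ?thesis using d s by (intro mult_nonneg_nonneg) auto
      qed
      then show "let d = real (vertex_degree E v) in
          (d - (s\<^sup>2 + 1)) * (d * ((s - 1) * (s - 3)) - 4 * (s\<^sup>2 + 1)) \<ge> 0"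
        by (simp add: Let_def c s2)
    qed
    also have "\<dots> = (15 + 6 * sqrt 2) / 19" by (simp add: s2 s_def)
    finally show ?thesis .
  qed
  show ?thesis using small large by (simp add: Let_def D_def)
qed

end
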